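(* Let $(m_n)_{n\ge 1}$ be a sequence of positive integers such that $m_n/\log n\to\infty$ as $n\to\infty$. Then there exists a sequence $(\varepsilon_n)_{n\ge 2}$ of positive real numbers, depending only on the sequence $(m_n)_{n\ge 1}$ and tending to zero as $n\to\infty$, such that the following holds. For all integers $n\ge 2$, all nondecreasing sequences $(r_j^{(n)})_{1\le j\le n}$ of positive real numbers, and all integers $1\le \ell\le n-1$ and $0\le q\le m_n-1$, the roots of the $(\ell m_n-q)$-th derivative of $$P_{n,m_n}(z)=\prod_{j=1}^{n}\bigl(z^{m_n}-(r_j^{(n)})^{m_n}\bigr)$$ are - $0$ with multiplicity $q$; - $s_j e^{2\pi i k/m_n}$ for $1\le j\le n-\ell$ and $0\le k\le m_n-1$, where the moduli $s_j$ satisfy, for $1\le j\le n-\ell$, $$r_{j+\ell}^{(n)}\,e^{-\varepsilon_n}\,\frac{j-n\varepsilon_n}{j+\ell-n\varepsilon_n}\,\mathbf{1}_{j\ge n\varepsilon_n}\;\le\; s_j\;\le\; r_{j+\ell}^{(n)}\,e^{\varepsilon_n}\left(\frac{j+1+n\varepsilon_n}{j+\ell+n\varepsilon_n}\right)^{e^{-\varepsilon_n}} .$$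
   Context: $\mathbf{1}_{j\ge n\varepsilon_n}$ equals $1$ if $j\ge n\varepsilon_n$ and $0$ otherwise; the lower bound is understood to be $0$ when $j<n\varepsilon_n$. Roots are listed with multiplicity (the values $s_j$, which are positive, need not be distinct). *)

theory Defs
  imports Complex_Main "HOL-Computational_Algebra.Computational_Algebra"
begin

definition P_poly :: "nat \<Rightarrow> nat \<Rightarrow> (nat \<Rightarrow> real) \<Rightarrow> complex poly" where
  "P_poly n m r = (\<Prod>j=1..n. monom 1 m - [:complex_of_real (r j ^ m):])"

end

theory Submission
  imports Defs
begin

text \<open>
  Write $P(z) = Q(z^m)$, where the roots of $Q$ are the $r_j^m$. The $(\ell m - q)$-th derivative of
  $P$ is $z^q R(z^m)$, where the coefficient of $x^i$ in $R$ is that of $x^{i+\ell}$ in $Q$ times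
  $((i+\ell)m)!/(im+q)!$. Looking at imaginary parts of logarithmic derivatives, all roots of $R$ are
  positive. For a polynomial of degree $N \le n$ with positive roots $t_1 \le \dots \le t_N$, the
  quotient of the absolute values of the coefficients of $x^{i-1}$ and $x^i$ equals $t_i$ up to a
  factor $n$. Applied to $Q$ and to $R$, this gives the roots of $R$ up to a factor $n^2$, whose
  $m$-th root is $e^{2 \log n / m}$; the quotient of factorials gives the remaining factor between
  $(j-1)/(j+\ell-1)$ and $(j+1)/(j+\ell)$. So $\varepsilon_n = 2 \log n / m_n + 1/n$ works.
\<close>

section \<open>Polynomials with only positive roots, via logarithmic derivatives\<close>

definition pos_rooted :: "complex poly \<Rightarrow> bool" where
  "pos_rooted p \<longleftrightarrow> p \<noteq> 0 \<and> (\<forall>z. poly p z = 0 \<longrightarrow> (\<exists>x>0. z = complex_of_real x))"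

lemma Im_one_divide: "Im (1 / z) = - Im z / (cmod z)\<^sup>2"
  by (simp add: Im_divide cmod_power2)

text \<open>Each \<open>1 / (z - t)\<close> has imaginary part \<open>- Im z\<close> times a
  nonnegative weight, and so has \<open>a / z\<close>; the total weight is positive, hence
  \<open>z\<close> is real. At a real point that is not positive, no term is positive and at least
  one is negative, so the sum cannot vanish. Hypothesis \<open>ne\<close> excludes the sums without
  a nonzero term, keeping in mind that \<open>a / 0 = 0\<close>.\<close>

lemma sum_inverse_eq_0_imp_pos:
  fixes A :: "real multiset" and z :: complex and a :: real
  assumes A: "\<forall>t\<in>#A. t > 0" "\<forall>t\<in>#A. z \<noteq> of_real t" and a: "a \<ge> 0"
    and ne: "A \<noteq> {#} \<or> a > 0 \<and> z \<noteq> 0"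
    and eq: "(\<Sum>t\<in>#A. 1 / (z - of_real t)) + of_real a / z = 0"
  shows "\<exists>x>0. z = of_real x"
proof -
  \<comment> \<open>Total weight: the left side of \<open>eq\<close> has imaginary part
    \<open>- Im z * w\<close>.\<close>
  define w where "w = (\<Sum>t\<in>#A. 1 / (cmod (z - of_real t))\<^sup>2) + a / (cmod z)\<^sup>2"
  have sum_nonneg: "0 \<le> (\<Sum>t\<in>#B. 1 / (cmod (z - of_real t))\<^sup>2)" for B
    by (induction B) auto
  have w_pos: "w > 0"
  proof (cases "A = {#}")
    case True
    then show ?thesis using ne by (auto simp: w_def)
  next
    case False
    then obtain t B where B: "A = add_mset t B" by (meson multiset_cases)
    then have "0 < 1 / (cmod (z - of_real t))\<^sup>2" using A by simp
    moreover have "0 \<le> a / (cmod z)\<^sup>2" using a by simp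
    ultimately show ?thesis using sum_nonneg[of B] unfolding w_def B
      by (simp only: image_mset_add_mset sum_mset.add_mset)
  qed
  have "Im (\<Sum>t\<in>#B. 1 / (z - of_real t)) = - Im z * (\<Sum>t\<in>#B. 1 / (cmod (z - of_real t))\<^sup>2)" for B
    by (induction B) (simp_all add: Im_one_divide algebra_simps del: Im_divide_of_real)
  moreover have "Im (of_real a / z) = - Im z * (a / (cmod z)\<^sup>2)"
    by (simp add: Im_divide cmod_power2)
  ultimately have "- Im z * w = 0"
    using arg_cong[OF eq, of Im] by (simp add: w_def algebra_simps)
  then have "Im z = 0" using w_pos by simp
  then have z: "z = of_real (Re z)" by (simp add: complex_eq_iff)
  have "Re z > 0"
  proof (rule ccontr)
    assume neg: "\<not> Re z > 0"
    define x where "x = Re z"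
    have *: "(\<Sum>t\<in>#B. 1 / (z - of_real t)) = of_real (\<Sum>t\<in>#B. 1 / (x - t))" for B
      by (subst z) (induction B, simp_all add: x_def)
    have "(\<Sum>t\<in>#A. 1 / (x - t)) + a / x = 0"
    proof -
      have "complex_of_real ((\<Sum>t\<in>#A. 1 / (x - t)) + a / x) = 0"
        using eq unfolding * by (subst (asm) z) (simp add: x_def)
      then show ?thesis by (simp only: of_real_eq_0_iff)
    qed
    moreover have sum_le: "(\<Sum>t\<in>#B. 1 / (x - t)) \<le> 0" if "\<forall>t\<in>#B. t > 0" for B
      using that neg by (induction B) (auto simp: x_def intro!: add_nonpos_nonpos divide_nonneg_nonpos)
    moreover have "a / x \<le> 0" using a neg by (auto simp: x_def divide_nonneg_nonpos)
    moreover have "(\<Sum>t\<in>#A. 1 / (x - t)) < 0 \<or> a / x < 0"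
    proof (cases "A = {#}")
      case True
      then have "a > 0" "z \<noteq> 0" using ne by auto
      then have "x \<noteq> 0" using z by (auto simp: x_def)
      then show ?thesis using neg \<open>a > 0\<close> by (auto simp: x_def divide_pos_neg)
    next
      case False
      then obtain t B where B: "A = add_mset t B" by (meson multiset_cases)
      then have "1 / (x - t) < 0" using A neg by (auto simp: x_def)
      moreover have "(\<Sum>t\<in>#B. 1 / (x - t)) \<le> 0" using sum_le[of B] A(1) B by simp
      ultimately show ?thesis unfolding B by (simp add: add_neg_nonpos del: divide_less_0_1_iff)
    qed
    ultimately show False using A(1)
      by (metis add_neg_nonpos add_nonpos_neg less_irrefl)
  qed
  then show ?thesis using z by blast
qed

lemma poly_pderiv_prod_linear:
  fixes z :: "'a :: field"
  assumes "\<forall>t\<in>#A. z \<noteq> t"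
  shows "poly (pderiv (\<Prod>t\<in>#A. [:-t, 1:])) z = poly (\<Prod>t\<in>#A. [:-t, 1:]) z * (\<Sum>t\<in>#A. 1 / (z - t))"
  using assms
proof (induction A)
  case (add x A)
  let ?p = "\<Prod>t\<in>#A. [:-t, 1:]"
  have "pderiv (\<Prod>t\<in>#add_mset x A. [:-t, 1:]) = [:-x, 1:] * pderiv ?p + ?p"
    by (simp only: image_mset_add_mset prod_mset.add_mset pderiv_mult) (simp add: pderiv_pCons)
  then have "poly (pderiv (\<Prod>t\<in>#add_mset x A. [:-t, 1:])) z = (z - x) * poly (pderiv ?p) z + poly ?p z"
    by (simp only: poly_add poly_mult) (simp add: algebra_simps)
  also have "\<dots> = (z - x) * poly ?p z * (1 / (z - x) + (\<Sum>t\<in>#A. 1 / (z - t)))"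
    using add by (simp add: distrib_left)
  also have "(z - x) * poly ?p z = poly (\<Prod>t\<in>#add_mset x A. [:-t, 1:]) z"
    by (simp add: algebra_simps)
  finally show ?case by simp
qed auto

lemma pos_rooted_proots:
  assumes "pos_rooted p"
  obtains A where "proots p = image_mset complex_of_real A" "\<forall>t\<in>#A. t > 0"
proof
  have *: "z = of_real (Re z) \<and> Re z > 0" if "z \<in># proots p" for z
    using that assms by (auto simp: pos_rooted_def)
  have "image_mset complex_of_real (image_mset Re (proots p)) = image_mset (\<lambda>z. z) (proots p)"
    unfolding image_mset.compositionality by (rule image_mset_cong) (use * in auto)
  then show "proots p = image_mset complex_of_real (image_mset Re (proots p))" by simp
  show "\<forall>t\<in>#image_mset Re (proots p). t > 0" using * by auto
qed

text \<open>Off the roots of \<open>p\<close>, division by \<open>poly p z\<close> turns the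
  equation into a vanishing sum of inverses. The case \<open>a = 0\<close> serves the plain
  derivative, the case \<open>a > 0\<close> the combination of \<open>p\<close> with
  \<open>x p'\<close>; these are the two changes that repeated differentiation will cause.\<close>

lemma pos_rooted_log_deriv:
  assumes p: "pos_rooted p" and z: "poly p z \<noteq> 0" and a: "a \<ge> 0"
    and ne: "degree p > 0 \<or> a > 0 \<and> z \<noteq> 0"
    and eq: "poly (pderiv p) z + of_real a / z * poly p z = 0"
  shows "\<exists>x>0. z = complex_of_real x"
proof -
  obtain A where A: "proots p = image_mset complex_of_real A" "\<forall>t\<in>#A. t > 0"
    using pos_rooted_proots[OF p] .
  have p0: "p \<noteq> 0" using z by auto
  have nz: "\<forall>t\<in>#proots p. z \<noteq> t" using z p0 by auto
  have p_eq: "p = smult (lead_coeff p) (\<Prod>t\<in>#proots p. [:-t, 1:])"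
    by (rule complex_poly_decompose_multiset[symmetric])
  have "poly (pderiv p) z = poly p z * (\<Sum>t\<in>#proots p. 1 / (z - t))"
    by (subst (1 2) p_eq) (simp only: pderiv_smult poly_smult poly_pderiv_prod_linear[OF nz] mult.assoc)
  then have "poly p z * ((\<Sum>t\<in>#proots p. 1 / (z - t)) + of_real a / z) = 0"
    using eq by (simp add: algebra_simps)
  then have eq': "(\<Sum>t\<in>#A. 1 / (z - of_real t)) + of_real a / z = 0"
    using z by (simp add: A(1) image_mset.compositionality o_def)
  have "A \<noteq> {#} \<or> a > 0 \<and> z \<noteq> 0"
    using ne A(1) size_proots_complex[of p] by auto
  then show ?thesis
    using sum_inverse_eq_0_imp_pos[of A z a] A nz a eq' by auto
qed

lemma pos_rooted_pderiv:
  assumes "pos_rooted p" "degree p > 0"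
  shows "pos_rooted (pderiv p)"
  unfolding pos_rooted_def
proof (intro conjI allI impI)
  show "pderiv p \<noteq> 0" using assms by (auto simp: pderiv_eq_0_iff)
  fix z assume "poly (pderiv p) z = 0"
  then show "\<exists>x>0. z = complex_of_real x"
    using assms pos_rooted_log_deriv[of p z 0] by (cases "poly p z = 0") (auto simp: pos_rooted_def)
qed

text \<open>This operator describes what differentiating z^(q+1) g(z^m) does to g. Its value at 0 is
  \<open>a\<close> times the nonzero \<open>poly p 0\<close>, so a root \<open>z\<close> is nonzero;
  dividing by \<open>b * z\<close> leads to the logarithmic derivative with parameter
  \<open>a / b\<close>.\<close>

lemma pos_rooted_euler:
  assumes p: "pos_rooted p" and a: "a > 0" and b: "b > 0"
  shows "pos_rooted (smult (of_real a) p + smult (of_real b) (pCons 0 (pderiv p)))" (is "pos_rooted ?g")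
  unfolding pos_rooted_def
proof (intro conjI allI impI)
  have p0: "poly p 0 \<noteq> 0" using p by (auto simp: pos_rooted_def)
  then have "poly ?g 0 \<noteq> 0" using a by simp
  then show "?g \<noteq> 0" by (metis poly_0)
  fix z assume z: "poly ?g z = 0"
  have "z \<noteq> 0" using z \<open>poly ?g 0 \<noteq> 0\<close> by auto
  then have "poly (pderiv p) z + of_real (a / b) / z * poly p z = 0"
    using z b by (simp add: field_simps)
  then show "\<exists>x>0. z = complex_of_real x"
    using p a b \<open>z \<noteq> 0\<close> pos_rooted_log_deriv[of p z "a/b"] by (cases "poly p z = 0") (auto simp: pos_rooted_def)
qed

text \<open>The i-th coefficient is multiplied by a + b i > 0, so the leading one survives.\<close>

lemma degree_euler:
  fixes p :: "complex poly"
  assumes "a > 0" "b > 0"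
  shows "degree (smult (of_real a) p + smult (of_real b) (pCons 0 (pderiv p))) = degree p" (is "degree ?g = _")
proof (rule antisym)
  have coeff: "coeff ?g i = of_real (a + b * real i) * coeff p i" for i
    by (cases i) (simp_all add: coeff_pderiv algebra_simps)
  show "degree ?g \<le> degree p"
    by (intro degree_le allI impI) (simp only: coeff coeff_eq_0 mult_zero_right)
  show "degree p \<le> degree ?g"
  proof (cases "p = 0")
    case False
    have "a + b * real (degree p) > 0" using assms by (simp add: add_pos_nonneg)
    then have "coeff ?g (degree p) \<noteq> 0"
      unfolding coeff using False
      by (simp del: of_real_add of_real_mult)
    then show ?thesis by (rule le_degree)
  qed auto
qed

section \<open>Higher derivatives of p(z^m)\<close>

lemma pderiv_monom_mult_pcompose:
  fixes g :: "complex poly"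
  assumes "m > 0"
  shows "pderiv (monom 1 (Suc q) * pcompose g (monom 1 m)) =
    monom 1 q * pcompose (smult (of_nat (Suc q)) g + smult (of_nat m) (pCons 0 (pderiv g))) (monom 1 m)"
proof -
  obtain k where k: "m = Suc k" using assms by (cases m) auto
  have "monom 1 (Suc q) * pderiv (monom 1 m) = monom (of_nat m) (q + m)"
    by (simp add: pderiv_monom mult_monom k)
  also have "\<dots> = smult (of_nat m) (monom 1 q * monom (1::complex) m)"
    by (simp add: mult_monom smult_monom)
  finally have *: "monom 1 (Suc q) * pderiv (monom 1 m) = smult (of_nat m) (monom 1 q * monom (1::complex) m)" .
  have **: "pderiv (monom 1 (Suc q)) = smult (of_nat (Suc q)) (monom (1::complex) q)"
    by (simp add: pderiv_monom smult_monom)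
  \<comment> \<open>Since z^(q+1) m z^(m-1) = m z^m z^q, the chain rule leaves an extra factor z^m,
    which becomes the \<open>pCons 0\<close> inside the composition.\<close>
  have "pderiv (monom 1 (Suc q) * pcompose g (monom 1 m)) =
      pderiv (monom 1 (Suc q)) * pcompose g (monom 1 m)
      + pcompose (pderiv g) (monom 1 m) * (monom 1 (Suc q) * pderiv (monom 1 m))"
    by (simp only: pderiv_mult pderiv_pcompose mult_ac add_ac)
  then show ?thesis unfolding * **
    by (simp add: pcompose_add pcompose_smult pcompose_pCons algebra_simps del: of_nat_Suc)
qed

text \<open>Induction on the number \<open>d\<close> of derivatives, written as l m - q with q < m.
  One more derivative either lowers the exponent of the monomial from q + 1 to q and applies the
  operator of \<open>pos_rooted_euler\<close> to \<open>g\<close>, or, if that exponent is 0,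
  produces z^(m-1), replaces \<open>g\<close> by m g' and raises \<open>l\<close> by one. Both
  changes keep all roots positive. The factorials come from differentiating each z^((i+l)m).\<close>

lemma higher_pderiv_pcompose_monom:
  fixes p :: "complex poly"
  assumes p: "pos_rooted p" and m: "m > 0"
    and "d + q = l * m" "q < m" "l \<le> degree p"
  shows "\<exists>g. pos_rooted g \<and> degree g + l = degree p \<and>
    (pderiv ^^ d) (pcompose p (monom 1 m)) = monom 1 q * pcompose g (monom 1 m) \<and>
    (\<forall>i. coeff g i * fact (i * m + q) = coeff p (i + l) * fact ((i + l) * m))"
  using assms(3-)
proof (induction d arbitrary: l q)
  case 0
  then have "l = 0" "q = 0" using m by (auto intro: ccontr)
  then show ?case using p by (intro exI[of _ p]) auto
next
  case (Suc d)
  show ?case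
  proof (cases "Suc q < m")
    case True
    then obtain g where g: "pos_rooted g" "degree g + l = degree p"
      "(pderiv ^^ d) (pcompose p (monom 1 m)) = monom 1 (Suc q) * pcompose g (monom 1 m)"
      "\<And>i. coeff g i * fact (i * m + Suc q) = coeff p (i + l) * fact ((i + l) * m)"
      using Suc.IH[of "Suc q" l] Suc.prems by auto
    define h where "h = smult (of_nat (Suc q)) g + smult (of_nat m) (pCons 0 (pderiv g))"
    have h_alt: "h = smult (of_real (real (Suc q))) g + smult (of_real (real m)) (pCons 0 (pderiv g))"
      by (simp add: h_def)
    have coeff: "coeff h i = of_nat (i * m + Suc q) * coeff g i" for i
      by (cases i) (simp_all add: h_def coeff_pderiv algebra_simps)
    have "coeff h i * fact (i * m + q) = coeff p (i + l) * fact ((i + l) * m)" for i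
      using g(4)[of i] by (simp add: coeff algebra_simps)
    moreover have "(pderiv ^^ Suc d) (pcompose p (monom 1 m)) = monom 1 q * pcompose h (monom 1 m)"
      using g(3) m by (simp add: pderiv_monom_mult_pcompose h_def del: of_nat_Suc)
    moreover have "pos_rooted h" "degree h = degree g"
      unfolding h_alt using m g(1) by (intro pos_rooted_euler degree_euler; simp)+
    ultimately show ?thesis using g(2) by auto
  next
    case False
    then have q: "Suc q = m" using Suc.prems by simp
    obtain l' where l: "l = Suc l'" using Suc.prems by (cases l) auto
    have "d + 0 = l' * m" using Suc.prems q l by simp
    then obtain g where g: "pos_rooted g" "degree g + l' = degree p"
      "(pderiv ^^ d) (pcompose p (monom 1 m)) = monom 1 0 * pcompose g (monom 1 m)"
      "\<And>i. coeff g i * fact (i * m + 0) = coeff p (i + l') * fact ((i + l') * m)"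
      using Suc.IH[of 0 l'] Suc.prems l by auto
    \<comment> \<open>As \<open>l \<le> degree p\<close>, the polynomial is not yet constant, so its
      derivative is nonzero.\<close>
    have dg: "degree g > 0" using g(2) Suc.prems l by simp
    define h where "h = smult (of_nat m) (pderiv g)"
    have "pos_rooted h"
      using pos_rooted_pderiv[OF g(1) dg] m by (auto simp: h_def pos_rooted_def)
    moreover have "degree h + l = degree p" using m dg g(2) l by (simp add: h_def degree_pderiv)
    moreover have "(pderiv ^^ Suc d) (pcompose p (monom 1 m)) = monom 1 q * pcompose h (monom 1 m)"
    proof -
      have "pderiv (monom 1 m) = smult (of_nat m) (monom (1::complex) q)"
        using q by (auto simp: pderiv_monom smult_monom)
      then show ?thesis using g(3) by (simp add: pderiv_pcompose h_def pcompose_smult mult_ac)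
    qed
    moreover have "coeff h i * fact (i * m + q) = coeff p (i + l) * fact ((i + l) * m)" for i
    proof -
      have "Suc i * m = Suc (i * m + q)" using q by simp
      then have "fact (Suc i * m) = of_nat (Suc i * m) * (fact (i * m + q) :: complex)"
        by (simp only: fact_Suc)
      then show ?thesis
        using g(4)[of "Suc i"] by (simp add: h_def coeff_pderiv l algebra_simps)
    qed
    ultimately show ?thesis by blast
  qed
qed

section \<open>Ratios of neighbouring coefficients and sorted roots\<close>

lemma coeff_mult_linear:
  fixes p :: "'a::comm_ring_1 poly"
  shows "coeff (p * [:c, 1:]) i = (if i = 0 then 0 else coeff p (i - 1)) + c * coeff p i"
  by (cases i) (simp_all add: algebra_simps)

text \<open>For i <= N, the coefficient of x^i is the elementary symmetric polynomial of degree N -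
  i in t_1, ..., t_N. The plus signs make all coefficients nonnegative for positive
  \<open>t\<close>.\<close>

definition linprod :: "nat \<Rightarrow> (nat \<Rightarrow> real) \<Rightarrow> real poly" where
  "linprod N t = (\<Prod>j=1..N. [:t j, 1:])"

lemma linprod_0: "linprod 0 t = 1"
  by (simp add: linprod_def)

lemma coeff_linprod_Suc:
  "coeff (linprod (Suc N) t) i =
    (if i = 0 then 0 else coeff (linprod N t) (i - 1)) + t (Suc N) * coeff (linprod N t) i"
proof -
  have "linprod (Suc N) t = linprod N t * [:t (Suc N), 1:]"
    by (simp add: linprod_def mult.commute)
  then show ?thesis by (simp only: coeff_mult_linear)
qed

lemma coeff_linprod_top: "coeff (linprod N t) i = (if i = N then 1 else 0)" if "i \<ge> N"
  using that
proof (induction N arbitrary: i)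
  case (Suc N)
  then show ?case by (auto simp: coeff_linprod_Suc)
qed (auto simp: linprod_0 coeff_1)

lemma coeff_linprod_nonneg:
  "\<forall>j\<in>{1..N}. t j > 0 \<Longrightarrow> coeff (linprod N t) i \<ge> 0"
proof (induction N arbitrary: i)
  case (Suc N)
  then have "coeff (linprod N t) k \<ge> 0" for k by auto
  moreover have "t (Suc N) \<ge> 0" using Suc.prems by (simp add: less_imp_le)
  ultimately show ?case by (simp add: coeff_linprod_Suc)
qed (simp add: linprod_0 coeff_1)

lemma coeff_linprod_pos:
  "\<forall>j\<in>{1..N}. t j > 0 \<Longrightarrow> i \<le> N \<Longrightarrow> coeff (linprod N t) i > 0"
proof (induction N arbitrary: i)
  case (Suc N)
  then have nn: "coeff (linprod N t) k \<ge> 0" for k by (intro coeff_linprod_nonneg) auto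
  show ?case
  proof (cases "i = Suc N")
    case False
    then have "coeff (linprod N t) i > 0" "t (Suc N) > 0" using Suc by auto
    then show ?thesis using nn by (auto simp: coeff_linprod_Suc intro: add_nonneg_pos)
  qed (simp add: coeff_linprod_top)
qed (auto simp: linprod_0)

text \<open>Combinatorially: a set of N - i indices omits only i, so it contains one of the first i
  + 1. Removing that index costs a factor at most t_(i+1), and each smaller set arises at most i + 1
  times. The proof uses the recursion in \<open>N\<close> instead.\<close>

lemma coeff_linprod_upper:
  assumes "\<forall>j\<in>{1..N}. t j > 0" "mono_on {1..N} t" "i < N"
  shows "coeff (linprod N t) i \<le> real (Suc i) * t (Suc i) * coeff (linprod N t) (Suc i)"
  using assms
proof (induction N arbitrary: i)
  case (Suc N)
  let ?c = "coeff (linprod N t)"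
  have pos: "\<forall>j\<in>{1..N}. t j > 0" and mono: "mono_on {1..N} t"
    using Suc.prems by (auto intro: mono_on_subset)
  have nn: "?c k \<ge> 0" for k by (intro coeff_linprod_nonneg pos)
  have IH: "?c k \<le> real (Suc k) * t (Suc k) * ?c (Suc k)" if "k < N" for k
    using Suc.IH[OF pos mono that] .
  \<comment> \<open>The \<open>Suc i\<close> copies of \<open>t (Suc i) * ?c i\<close> on the right
    are split: \<open>i\<close> of them bound the term from index \<open>i - 1\<close>, and the last
    one goes into \<open>upper\<close>, where it settles the case \<open>i = N\<close>.\<close>
  have lower: "(if i = 0 then 0 else ?c (i - 1)) \<le> real i * t (Suc i) * ?c i"
  proof (cases i)
    case (Suc k)
    have "t (Suc k) \<le> t (Suc i)"
      using Suc Suc.prems by (intro mono_onD[OF Suc.prems(2)]) auto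
    then have "real (Suc k) * t (Suc k) * ?c (Suc k) \<le> real (Suc k) * t (Suc i) * ?c (Suc k)"
      by (intro mult_right_mono mult_left_mono nn) auto
    with IH[of k] have "?c k \<le> real (Suc k) * t (Suc i) * ?c (Suc k)" using Suc Suc.prems by linarith
    then show ?thesis by (simp add: Suc)
  qed auto
  have upper: "t (Suc N) * ?c i \<le> t (Suc i) * ?c i + real (Suc i) * t (Suc i) * (t (Suc N) * ?c (Suc i))"
  proof (cases "i = N")
    case False
    then have "t (Suc N) * ?c i \<le> t (Suc N) * (real (Suc i) * t (Suc i) * ?c (Suc i))"
      using Suc.prems IH[of i] by (intro mult_left_mono) (auto simp: less_imp_le)
    moreover have "t (Suc i) * ?c i \<ge> 0" using nn Suc.prems by (intro mult_nonneg_nonneg) (auto simp: less_imp_le)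
    ultimately show ?thesis by (simp add: mult_ac)
  qed (simp add: coeff_linprod_top)
  show ?case using lower upper
    by (auto simp: coeff_linprod_Suc algebra_simps)
qed auto

text \<open>Combinatorially: a set of N - i - 1 indices omits i + 1 of them, the largest of which is
  at least i + 1. Adding it gains a factor at least t_(i+1), and each larger set arises at most N -
  i times.\<close>

lemma coeff_linprod_lower:
  assumes "\<forall>j\<in>{1..N}. t j > 0" "mono_on {1..N} t" "i < N"
  shows "t (Suc i) * coeff (linprod N t) (Suc i) \<le> real (N - i) * coeff (linprod N t) i"
  using assms
proof (induction N arbitrary: i)
  case (Suc N)
  let ?c = "coeff (linprod N t)"
  have pos: "\<forall>j\<in>{1..N}. t j > 0" and mono: "mono_on {1..N} t"
    using Suc.prems by (auto intro: mono_on_subset)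
  have nn: "?c k \<ge> 0" for k by (intro coeff_linprod_nonneg pos)
  \<comment> \<open>Passing from \<open>N - i\<close> to \<open>Suc N - i\<close> supplies one more
    copy of \<open>t (Suc N) * ?c i\<close>, which absorbs the term
    \<open>t (Suc i) * ?c i\<close>.\<close>
  have "t (Suc i) \<le> t (Suc N)"
    using Suc.prems by (intro mono_onD[OF Suc.prems(2)]) auto
  then have "t (Suc i) * ?c i \<le> t (Suc N) * ?c i" by (intro mult_right_mono nn)
  moreover have "t (Suc i) * (t (Suc N) * ?c (Suc i)) \<le> real (N - i) * (t (Suc N) * ?c i)"
  proof (cases "i = N")
    case False
    then have "t (Suc N) * (t (Suc i) * ?c (Suc i)) \<le> t (Suc N) * (real (N - i) * ?c i)"
      using Suc.prems Suc.IH[OF pos mono] by (intro mult_left_mono) (auto simp: less_imp_le)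
    then show ?thesis by (simp add: mult_ac)
  qed (simp add: coeff_linprod_top)
  moreover have "0 \<le> real (Suc N - i) * (if i = 0 then 0 else ?c (i - 1))" using nn by auto
  moreover have "real (Suc N - i) = real (N - i) + 1" using Suc.prems by (simp add: Suc_diff_le)
  ultimately show ?case
    by (simp add: coeff_linprod_Suc algebra_simps)
qed auto

lemma norm_coeff_prod_linear:
  "norm (coeff (\<Prod>j=1..N. [:- complex_of_real (t j), 1:]) i) = \<bar>coeff (linprod N t) i\<bar>"
proof -
  \<comment> \<open>The sign is (-1)^(N-i); a power on each side avoids truncated
    subtraction.\<close>
  have "(-1) ^ N * coeff (\<Prod>j=1..N. [:- complex_of_real (t j), 1:]) i = (-1) ^ i * of_real (coeff (linprod N t) i)"
  proof (induction N arbitrary: i)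
    case 0
    then show ?case by (cases i) (auto simp: linprod_0)
  next
    case (Suc N)
    let ?p = "\<Prod>j=1..N. [:- complex_of_real (t j), 1:]"
    have "(\<Prod>j=1..Suc N. [:- complex_of_real (t j), 1:]) = ?p * [:- of_real (t (Suc N)), 1:]"
      by (simp add: mult.commute)
    then have "(-1) ^ Suc N * coeff (\<Prod>j=1..Suc N. [:- complex_of_real (t j), 1:]) i
       = - (if i = 0 then 0 else (-1) ^ N * coeff ?p (i - 1)) + of_real (t (Suc N)) * ((-1) ^ N * coeff ?p i)"
      by (simp only: coeff_mult_linear) (simp add: algebra_simps)
    also have "\<dots> = (-1) ^ i * of_real (coeff (linprod (Suc N) t) i)"
      unfolding Suc.IH by (cases i) (simp_all add: coeff_linprod_Suc algebra_simps)
    finally show ?case .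
  qed
  from arg_cong[OF this, of norm] show ?thesis
    by (simp add: norm_mult norm_power)
qed

text \<open>The factors \<open>N - i\<close> and \<open>Suc i\<close> are both weakened to
  \<open>N\<close>, so that a root can be exchanged for a quotient of coefficients in either
  direction at the same cost.\<close>

lemma norm_coeff_ratio_bounds:
  fixes p :: "complex poly"
  assumes p: "p = smult c (\<Prod>j=1..N. [:- of_real (t j), 1:])" and c: "c \<noteq> 0"
    and t: "\<forall>j\<in>{1..N}. t j > 0" "mono_on {1..N} t" and i: "i < N"
  shows "t (Suc i) * norm (coeff p (Suc i)) \<le> real N * norm (coeff p i)"
    and "norm (coeff p i) \<le> real N * t (Suc i) * norm (coeff p (Suc i))"
proof -
  have co: "norm (coeff p k) = norm c * coeff (linprod N t) k" for k
    using coeff_linprod_nonneg[OF t(1)] by (simp add: p norm_mult norm_coeff_prod_linear[simplified])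
  have nn: "coeff (linprod N t) k \<ge> 0" for k by (rule coeff_linprod_nonneg[OF t(1)])
  have "t (Suc i) * coeff (linprod N t) (Suc i) \<le> real (N - i) * coeff (linprod N t) i"
    by (rule coeff_linprod_lower[OF t i])
  also have "\<dots> \<le> real N * coeff (linprod N t) i" by (intro mult_right_mono nn) auto
  finally show "t (Suc i) * norm (coeff p (Suc i)) \<le> real N * norm (coeff p i)"
    unfolding co by (metis mult.left_commute mult_left_mono norm_ge_zero)
  have "coeff (linprod N t) i \<le> real (Suc i) * t (Suc i) * coeff (linprod N t) (Suc i)"
    by (rule coeff_linprod_upper[OF t i])
  also have "\<dots> \<le> real N * t (Suc i) * coeff (linprod N t) (Suc i)"
    using i t by (intro mult_right_mono nn) (auto simp: less_imp_le)
  finally show "norm (coeff p i) \<le> real N * t (Suc i) * norm (coeff p (Suc i))"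
    unfolding co by (metis mult.left_commute mult_left_mono norm_ge_zero)
qed

lemma norm_coeff_pos:
  fixes p :: "complex poly"
  assumes p: "p = smult c (\<Prod>j=1..N. [:- of_real (t j), 1:])" and c: "c \<noteq> 0"
    and t: "\<forall>j\<in>{1..N}. t j > 0" and i: "i \<le> N"
  shows "norm (coeff p i) > 0"
  using coeff_linprod_pos[OF t i] c norm_coeff_prod_linear[of t N i] by (auto simp: p)

section \<open>Sorted factorizations, and root multisets of polynomials in z^m\<close>

lemma pos_rooted_factorization:
  assumes "pos_rooted p"
  obtains c t where "c \<noteq> 0" "\<forall>j\<in>{1..degree p}. t j > 0" "mono_on {1..degree p} t"
    "p = smult c (\<Prod>j=1..degree p. [:- complex_of_real (t j), 1:])"
proof -
  obtain A where A: "proots p = image_mset complex_of_real A" "\<forall>t\<in>#A. t > 0"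
    using pos_rooted_proots[OF assms] .
  \<comment> \<open>Sorting gives the monotonicity; \<open>t\<close> shifts the list, indexed from
    0, to indices from 1.\<close>
  define xs where "xs = sorted_list_of_multiset A"
  define t where "t j = xs ! (j - 1)" for j
  have len: "length xs = degree p"
    unfolding xs_def by (metis A(1) mset_sorted_list_of_multiset size_image_mset size_mset size_proots_complex)
  have "(\<Prod>x\<in>#proots p. [:-x, 1:]) = (\<Prod>x\<leftarrow>xs. [:- complex_of_real x, 1:])"
    by (simp add: A(1) xs_def image_mset.compositionality o_def flip: prod_mset_prod_list)
  also have "\<dots> = (\<Prod>i<degree p. [:- complex_of_real (xs ! i), 1:])"
    by (subst prod.list_conv_set_nth) (auto simp: atLeast0LessThan len)
  also have "\<dots> = (\<Prod>j=1..degree p. [:- complex_of_real (t j), 1:])"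
    by (rule prod.reindex_bij_witness[of _ "\<lambda>j. j - 1" Suc]) (auto simp: t_def)
  finally have "p = smult (lead_coeff p) (\<Prod>j=1..degree p. [:- complex_of_real (t j), 1:])"
    by (metis complex_poly_decompose_multiset)
  moreover have "lead_coeff p \<noteq> 0" using assms by (simp add: pos_rooted_def)
  moreover have "mono_on {1..degree p} t"
    unfolding t_def
  proof (rule mono_onI)
    fix i j assume "i \<in> {1..degree p}" "j \<in> {1..degree p}" "i \<le> j"
    then show "xs ! (i - 1) \<le> xs ! (j - 1)"
      by (intro sorted_nth_mono) (auto simp: len xs_def[symmetric], simp add: xs_def)
  qed
  moreover have "\<forall>j\<in>{1..degree p}. t j > 0"
  proof
    fix j assume "j \<in> {1..degree p}"
    then have "t j \<in> set xs" unfolding t_def by (intro nth_mem) (auto simp: len)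
    then show "t j > 0" using A(2) by (simp add: xs_def)
  qed
  ultimately show ?thesis using that by blast
qed

lemma pos_rooted_prod_linear:
  assumes "\<forall>j\<in>{1..N}. t j > 0"
  shows "pos_rooted (\<Prod>j=1..N. [:- complex_of_real (t j), 1:])"
    and "degree (\<Prod>j=1..N. [:- complex_of_real (t j), 1:]) = N"
  using assms by (auto simp: pos_rooted_def poly_prod degree_prod_sum_eq)

lemma proots_monom_one: "proots (monom (1::'a::idom) q) = replicate_mset q 0"
proof -
  have "monom (1::'a) q = [:0, 1:] ^ q" by (simp add: monom_altdef)
  then show ?thesis by (simp add: proots_power)
qed

text \<open>The m-th roots of unity scaled by \<open>s\<close> are m distinct roots. They form a
  submultiset of all roots, and since the degree is m, equal sizes force equality, so every root is
  simple.\<close>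

lemma proots_monom_minus_power:
  assumes m: "m > 0" and s: "s > 0"
  shows "proots (monom 1 m - [:complex_of_real (s ^ m):]) =
    image_mset (\<lambda>k. complex_of_real s * exp (2 * complex_of_real pi * \<i> * of_nat k / of_nat m))
      (mset_set {0..m - 1})"
proof -
  let ?p = "monom 1 m - [:complex_of_real (s ^ m):]"
  define f where "f k = complex_of_real s * exp (2 * complex_of_real pi * \<i> * of_nat k / of_nat m)" for k
  have cis: "f k = of_real s * cis (2 * pi * real k / real m)" for k
    by (simp add: f_def cis_conv_exp mult_ac)
  have bij: "bij_betw (\<lambda>k. cis (2 * pi * real k / real m)) {..<m} {z. z ^ m = 1}"
    by (rule bij_betw_roots_unity[OF m])
  have K: "{0..m - 1} = {..<m}" using m by auto
  have inj: "inj_on f {0..m - 1}"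
    using bij_betw_imp_inj_on[OF bij] s unfolding K by (auto simp: inj_on_def cis)
  have f_pow: "f k ^ m = of_real (s ^ m)" if "k < m" for k
  proof -
    have "cis (2 * pi * real k / real m) ^ m = 1"
      using bij_betwE[OF bij] that by auto
    then show ?thesis unfolding cis power_mult_distrib by simp
  qed
  have "degree ?p = m"
    using m degree_add_eq_left[of "- [:complex_of_real (s ^ m):]" "monom 1 m"]
    by (simp add: degree_monom_eq diff_conv_add_uminus del: of_real_power add_uminus_conv_diff)
  then have size: "size (proots ?p) = m" and p0: "?p \<noteq> 0"
    using m by (auto simp: size_proots_complex)
  have "mset_set (f ` {0..m - 1}) \<subseteq># proots ?p"
  proof (rule mset_subset_eqI)
    fix z
    show "count (mset_set (f ` {0..m - 1})) z \<le> count (proots ?p) z"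
    proof (cases "z \<in> f ` {0..m - 1}")
      case True
      then have "poly ?p z = 0" using f_pow m by (auto simp: poly_monom K)
      then have "order z ?p > 0" using p0 order_root[of ?p z] by auto
      then show ?thesis using True p0 by simp
    qed simp
  qed
  moreover have "size (mset_set (f ` {0..m - 1})) = m"
    using inj m by (simp add: card_image)
  ultimately have "mset_set (f ` {0..m - 1}) = proots ?p"
    using size by (metis mset_subset_size less_irrefl subset_mset.le_neq_trans)
  then have "proots ?p = image_mset f (mset_set {0..m - 1})"
    using image_mset_mset_set[OF inj] by simp
  then show ?thesis by (simp only: f_def[abs_def])
qed

lemma sum_image_mset_eq_Times:
  assumes "finite A" "finite B"
  shows "(\<Sum>j\<in>A. image_mset (f j) (mset_set B)) = image_mset (\<lambda>(j, k). f j k) (mset_set (A \<times> B))"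
  using assms(1)
proof (induction A rule: finite_induct)
  case (insert x A)
  have "insert x A \<times> B = Pair x ` B \<union> A \<times> B" by auto
  moreover have "Pair x ` B \<inter> A \<times> B = {}" using insert by auto
  ultimately have "mset_set (insert x A \<times> B) = image_mset (Pair x) (mset_set B) + mset_set (A \<times> B)"
    using insert assms(2) by (simp add: mset_set_Union image_mset_mset_set inj_on_def)
  then show ?case using insert by (simp add: image_mset.compositionality o_def)
qed simp

lemma pcompose_prod_linear_monom:
  "pcompose (\<Prod>j=1..N. [:- t j, 1:]) (monom 1 m) = (\<Prod>j=1..N. monom 1 m - [:t j :: complex:])"
  by (simp add: pcompose_prod pcompose_pCons add.commute[of "[:_:]"] diff_conv_add_uminus
      del: add_uminus_conv_diff)

text \<open>Multisets are added over the factors z^m - s_j^m, so coinciding \<open>s j\<close> are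
  counted with multiplicity.\<close>

lemma proots_monom_mult_pcompose:
  fixes s :: "nat \<Rightarrow> real"
  assumes m: "m > 0" and c: "c \<noteq> 0" and s: "\<forall>j\<in>{1..N}. s j > 0"
    and g: "g = smult c (\<Prod>j=1..N. [:- complex_of_real (s j ^ m), 1:])"
  shows "proots (monom 1 q * pcompose g (monom 1 m)) =
    replicate_mset q 0 +
    image_mset (\<lambda>(j, k). complex_of_real (s j) * exp (2 * complex_of_real pi * \<i> * of_nat k / of_nat m))
      (mset_set ({1..N} \<times> {0..m - 1}))"
proof -
  let ?f = "\<lambda>j. monom 1 m - [:complex_of_real (s j ^ m):]"
  have ne: "?f j \<noteq> 0" for j
  proof -
    have "coeff (?f j) m = 1" using m by (simp add: coeff_pCons split: nat.split)
    then show ?thesis by (metis coeff_0 zero_neq_one)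
  qed
  have g': "pcompose g (monom 1 m) = smult c (prod ?f {1..N})"
    by (simp only: g pcompose_smult pcompose_prod_linear_monom)
  have "prod ?f {1..N} \<noteq> 0" using ne by (subst prod_zero_iff) auto
  then have "proots (monom 1 q * pcompose g (monom 1 m)) = replicate_mset q 0 + proots (prod ?f {1..N})"
    unfolding g' using c by (simp add: proots_mult proots_monom_one)
  also have "proots (prod ?f {1..N}) = (\<Sum>j\<in>{1..N}. proots (?f j))"
    by (rule proots_prod) (rule ne)
  also have "\<dots> = (\<Sum>j\<in>{1..N}. image_mset (\<lambda>k. complex_of_real (s j) *
      exp (2 * complex_of_real pi * \<i> * of_nat k / of_nat m)) (mset_set {0..m - 1}))"
    using s m by (intro sum.cong refl proots_monom_minus_power) auto
  finally show ?thesis by (simp only: sum_image_mset_eq_Times[OF finite_atLeastAtMost finite_atLeastAtMost])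
qed

section \<open>Quotients of factorials and the resulting bounds on roots\<close>

lemma fact_add_eq_prod: "fact (a + k) = fact a * (\<Prod>p=1..k. real (a + p))"
  by (induction k) (simp_all add: algebra_simps)

text \<open>Each factorial quotient is a product of m linear factors, and these are compared one by
  one.\<close>

lemma fact_ratio_le:
  fixes x y :: nat and a b :: real
  assumes "a \<ge> 0" "\<And>p. p \<in> {1..m} \<Longrightarrow> a * real (x + p) \<le> b * real (y + p)"
  shows "a ^ m * (fact (x + m) * fact y) \<le> b ^ m * (fact (y + m) * fact x)"
proof -
  have "(\<Prod>p=1..m. a * real (x + p)) \<le> (\<Prod>p=1..m. b * real (y + p))"
    using assms by (intro prod_mono) auto
  then have "fact x * fact y * (a ^ m * (\<Prod>p=1..m. real (x + p)))
      \<le> fact x * fact y * (b ^ m * (\<Prod>p=1..m. real (y + p)))"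
    by (intro mult_left_mono) (auto simp: prod.distrib)
  then show ?thesis by (simp only: fact_add_eq_prod mult_ac)
qed

text \<open>The root t_(i+1) is close to the quotient of the coefficients i and i + 1 of
  \<open>g\<close>. By \<open>rel\<close> this is the quotient of the coefficients i + l and i + l +
  1 of \<open>p\<close>, which is close to r_(i+l+1), times a quotient of factorials. Each exchange
  costs a factor at most n, hence \<open>real n ^ 2\<close>.\<close>

lemma root_bounds_from_coeff_relation:
  fixes g p :: "complex poly" and t :: "nat \<Rightarrow> real" and l :: nat
  assumes p: "p = smult b (\<Prod>j=1..n. [:- complex_of_real (r j), 1:])" "b \<noteq> 0"
    "\<forall>j\<in>{1..n}. r j > 0" "mono_on {1..n} r"
    and g: "g = smult c (\<Prod>j=1..N. [:- complex_of_real (t j), 1:])" "c \<noteq> 0"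
    "\<forall>j\<in>{1..N}. t j > 0" "mono_on {1..N} t"
    and N: "N + l = n" and l: "l \<ge> 1" and q: "q < m" and i: "i < N"
    and rel: "\<And>i. coeff g i * fact (i * m + q) = coeff p (i + l) * fact ((i + l) * m)"
  shows "r (Suc i + l) * real i ^ m \<le> real n ^ 2 * t (Suc i) * real (i + l) ^ m"
    and "t (Suc i) * real (i + l + 1) ^ m \<le> real n ^ 2 * r (Suc i + l) * real (i + 2) ^ m"
proof -
  define G where "G k = norm (coeff g k)" for k
  define Q where "Q k = norm (coeff p k)" for k
  have rel': "G k * fact (k * m + q) = Q (k + l) * fact ((k + l) * m)" for k
    using arg_cong[OF rel[of k], of norm] by (simp add: G_def Q_def norm_mult)
  have il: "i + l < n" using i N by simp
  have Gpos: "G (Suc i) > 0" unfolding G_def by (rule norm_coeff_pos[OF g(1-3)]) (use i in simp)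
  have rpos: "r (Suc i + l) > 0" and tpos: "t (Suc i) > 0" using p(3) g(3) il i by auto
  note ratio_g = norm_coeff_ratio_bounds[OF g i, folded G_def]
  note ratio_p = norm_coeff_ratio_bounds[OF p il, folded Q_def]
  define a where "a = (fact (i * m + q) :: real)"
  define a' where "a' = (fact (i * m + q + m) :: real)"
  define d where "d = (fact ((i + l) * m) :: real)"
  define d' where "d' = (fact ((i + l) * m + m) :: real)"
  have pos: "a > 0" "a' > 0" "d > 0" "d' > 0" by (simp_all add: a_def a'_def d_def d'_def)
  have rel0: "G i * a = Q (i + l) * d" using rel'[of i] by (simp add: a_def d_def)
  have rel1: "G (Suc i) * a' = Q (Suc (i + l)) * d'"
    using rel'[of "Suc i"] by (simp add: a'_def d'_def algebra_simps)
  have Nn: "real N \<le> real n" using N by simp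
  \<comment> \<open>Factorwise, (i + l)(i m + q + k) exceeds i((i + l) m + k) by (i + l) q + l
    k.\<close>
  have f1: "real i ^ m * (d' * a) \<le> real (i + l) ^ m * (a' * d)"
    unfolding a_def a'_def d_def d'_def
    by (rule fact_ratio_le) (auto simp: algebra_simps)
  have f2: "real (i + l + 1) ^ m * (a' * d) \<le> real (i + 2) ^ m * (d' * a)"
    unfolding a_def a'_def d_def d'_def
  proof (rule fact_ratio_le)
    \<comment> \<open>The right side minus the left is m(i + 2l) - (l - 1)k - (i + l + 1)q. It is
      smallest when k and q are replaced by m, where it is exactly 0; this is the origin of the
      constant i + 2.\<close>
    fix k assume "k \<in> {1..m}"
    then have "real k * (real l - 1) \<le> real m * (real l - 1)"
      using l by (intro mult_right_mono) auto
    moreover have "(real i + real l + 1) * real q \<le> (real i + real l + 1) * real m"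
      using q by (intro mult_left_mono) auto
    ultimately show "real (i + l + 1) * real (i * m + q + k) \<le> real (i + 2) * real ((i + l) * m + k)"
      by (simp add: algebra_simps)
  qed simp
  \<comment> \<open>Without division: r_(i+l+1) is at most n^2 t_(i+1) (d' a) / (a' d). Then
    \<open>f1\<close> bounds the factorials.\<close>
  have "G (Suc i) * (r (Suc i + l) * (a' * d)) = r (Suc (i + l)) * Q (Suc (i + l)) * (d' * d)"
    using rel1 by (simp add: mult_ac)
  also have "\<dots> \<le> real n * Q (i + l) * (d' * d)"
    using ratio_p(1) pos by (intro mult_right_mono) auto
  also have "\<dots> = real n * G i * (d' * a)" using rel0 by (simp add: mult_ac)
  also have "\<dots> \<le> real n * (real n * t (Suc i) * G (Suc i)) * (d' * a)"
  proof (intro mult_right_mono mult_left_mono)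
    have "real N * t (Suc i) * G (Suc i) \<le> real n * t (Suc i) * G (Suc i)"
      using Nn tpos Gpos by (intro mult_right_mono) auto
    then show "G i \<le> real n * t (Suc i) * G (Suc i)" using ratio_g(2) by linarith
  qed (use pos in auto)
  finally have "G (Suc i) * (r (Suc i + l) * (a' * d)) \<le> G (Suc i) * (real n ^ 2 * t (Suc i) * (d' * a))"
    by (simp add: mult_ac power2_eq_square)
  then have e1: "r (Suc i + l) * (a' * d) \<le> real n ^ 2 * t (Suc i) * (d' * a)"
    using Gpos by simp
  have "(d' * a) * (r (Suc i + l) * real i ^ m) = r (Suc i + l) * (real i ^ m * (d' * a))"
    by (simp add: mult_ac)
  also have "\<dots> \<le> r (Suc i + l) * (real (i + l) ^ m * (a' * d))"
    using f1 rpos by (intro mult_left_mono) auto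
  also have "\<dots> = real (i + l) ^ m * (r (Suc i + l) * (a' * d))" by (simp add: mult_ac)
  also have "\<dots> \<le> real (i + l) ^ m * (real n ^ 2 * t (Suc i) * (d' * a))"
    using e1 by (intro mult_left_mono) auto
  finally have "(d' * a) * (r (Suc i + l) * real i ^ m) \<le> (d' * a) * (real n ^ 2 * t (Suc i) * real (i + l) ^ m)"
    by (simp add: mult_ac)
  moreover have "d' * a > 0" using pos by simp
  ultimately show "r (Suc i + l) * real i ^ m \<le> real n ^ 2 * t (Suc i) * real (i + l) ^ m"
    by (simp only: mult_le_cancel_left_pos)

  \<comment> \<open>The reverse estimate, with the other two coefficient bounds and
    \<open>f2\<close>.\<close>
  have "G (Suc i) * (t (Suc i) * (d' * a)) = t (Suc i) * G (Suc i) * (d' * a)" by (simp add: mult_ac)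
  also have "\<dots> \<le> real n * G i * (d' * a)"
  proof (intro mult_right_mono)
    have "real N * G i \<le> real n * G i" using Nn by (intro mult_right_mono) (auto simp: G_def)
    then show "t (Suc i) * G (Suc i) \<le> real n * G i" using ratio_g(1) by linarith
  qed (use pos in auto)
  also have "\<dots> = real n * Q (i + l) * (d' * d)" using rel0 by (simp add: mult_ac)
  also have "\<dots> \<le> real n * (real n * r (Suc (i + l)) * Q (Suc (i + l))) * (d' * d)"
    using ratio_p(2) pos by (intro mult_right_mono mult_left_mono) auto
  also have "\<dots> = real n * real n * r (Suc (i + l)) * (Q (Suc (i + l)) * d') * d" by (simp add: mult_ac)
  also have "\<dots> = G (Suc i) * (real n ^ 2 * r (Suc i + l) * (a' * d))"
    unfolding rel1[symmetric] by (simp add: mult_ac power2_eq_square)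
  finally have e2: "t (Suc i) * (d' * a) \<le> real n ^ 2 * r (Suc i + l) * (a' * d)"
    using Gpos by simp
  have "(a' * d) * (t (Suc i) * real (i + l + 1) ^ m) = t (Suc i) * (real (i + l + 1) ^ m * (a' * d))"
    by (simp add: mult_ac)
  also have "\<dots> \<le> t (Suc i) * (real (i + 2) ^ m * (d' * a))"
    using f2 tpos by (intro mult_left_mono) auto
  also have "\<dots> = real (i + 2) ^ m * (t (Suc i) * (d' * a))" by (simp add: mult_ac)
  also have "\<dots> \<le> real (i + 2) ^ m * (real n ^ 2 * r (Suc i + l) * (a' * d))"
    using e2 by (intro mult_left_mono) auto
  finally have "(a' * d) * (t (Suc i) * real (i + l + 1) ^ m) \<le> (a' * d) * (real n ^ 2 * r (Suc i + l) * real (i + 2) ^ m)"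
    by (simp add: mult_ac)
  moreover have "a' * d > 0" using pos by simp
  ultimately show "t (Suc i) * real (i + l + 1) ^ m \<le> real n ^ 2 * r (Suc i + l) * real (i + 2) ^ m"
    by (simp only: mult_le_cancel_left_pos)
qed

text \<open>Brings the bounds in i = j - 1, after taking m-th roots, into the required shape. The
  constant \<open>K\<close> is absorbed by \<open>exp e\<close>, and
  \<open>real n * e \<ge> 1\<close> absorbs the index shift in the lower bound.\<close>

lemma modulus_bounds:
  fixes r s e K :: real and n l i :: nat
  assumes r: "r > 0" and s: "s > 0" and K: "K \<le> exp e" "K > 0" and e: "real n * e \<ge> 1" "e > 0"
    and l: "l \<ge> 1"
    and lo: "r * real i \<le> K * s * real (i + l)"
    and up: "s * real (i + l + 1) \<le> K * r * real (i + 2)"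
  shows "r * exp (- e) * ((real (Suc i) - real n * e) / (real (Suc i) + real l - real n * e))
      * of_bool (real (Suc i) \<ge> real n * e) \<le> s"
    and "s \<le> r * exp e * ((real (Suc i) + 1 + real n * e) / (real (Suc i) + real l + real n * e)) powr exp (- e)"
proof -
  define x where "x = real n * e"
  show "r * exp (- e) * ((real (Suc i) - real n * e) / (real (Suc i) + real l - real n * e))
      * of_bool (real (Suc i) \<ge> real n * e) \<le> s"
  proof (cases "real (Suc i) \<ge> x")
    case True
    have il: "real i + real l > 0" using l by simp
    \<comment> \<open>The map u -> u / (u + l) is increasing for u >= 0, and here u = i + 1 - x is
      at most i.\<close>
    have "(real (Suc i) - x) / (real (Suc i) + real l - x) \<le> real i / (real i + real l)"
    proof -
      have "(real (Suc i) - x) * real l \<le> real i * real l"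
        using e l by (intro mult_right_mono) (auto simp: x_def)
      moreover have "real (Suc i) + real l - x > 0" using True l by simp
      ultimately show ?thesis using il by (simp add: divide_simps) (simp add: algebra_simps)
    qed
    then have "r * exp (- e) * ((real (Suc i) - x) / (real (Suc i) + real l - x)) \<le> r * exp (- e) * (real i / (real i + real l))"
      using r by (intro mult_left_mono) auto
    also have "\<dots> = exp (- e) * ((r * real i) / (real i + real l))" by simp
    also have "\<dots> \<le> exp (- e) * (K * s)"
      using lo il by (intro mult_left_mono) (auto simp: divide_simps)
    also have "\<dots> \<le> exp (- e) * (exp e * s)"
      using K s by (intro mult_left_mono mult_right_mono) auto
    also have "\<dots> = s" by (simp add: exp_minus)
    finally show ?thesis using True by (simp add: x_def)
  next
    case False
    then show ?thesis using s by (simp add: x_def)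
  qed
  define y where "y = (real (Suc i) + 1 + x) / (real (Suc i) + real l + x)"
  have x: "x \<ge> 1" using e by (simp add: x_def)
  have y: "0 \<le> y" "y \<le> 1" using l x by (auto simp: y_def)
  \<comment> \<open>Adding x to numerator and denominator of a fraction that is at most 1 does not
    decrease it.\<close>
  have "real (i + 2) / real (i + l + 1) \<le> y"
  proof -
    have "0 \<le> x * (real l - 1)" using x l by auto
    moreover have "real (Suc i) + real l + x > 0" using x by simp
    ultimately show ?thesis unfolding y_def by (simp add: divide_simps) (simp add: algebra_simps)
  qed
  also have "\<dots> = y powr 1" using y by simp
  \<comment> \<open>The base lies in [0, 1] and the exponent is at most 1, so the power only
    grows.\<close>
  also have "\<dots> \<le> y powr exp (- e)" using y e by (intro powr_mono') auto
  finally have "real (i + 2) / real (i + l + 1) \<le> y powr exp (- e)" .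
  then have "K * r * (real (i + 2) / real (i + l + 1)) \<le> exp e * r * y powr exp (- e)"
    using K r by (intro mult_mono) auto
  moreover have "s \<le> K * r * (real (i + 2) / real (i + l + 1))"
    using up by (simp add: divide_simps)
  ultimately show "s \<le> r * exp e * ((real (Suc i) + 1 + real n * e) / (real (Suc i) + real l + real n * e)) powr exp (- e)"
    by (simp add: y_def x_def mult_ac)
qed

text \<open>The assertion for a fixed n, isolating the three conditions that
  \<open>\<epsilon> n\<close> has to meet.\<close>

lemma higher_pderiv_P_poly:
  fixes r :: "nat \<Rightarrow> real" and e :: real
  assumes n: "n \<ge> 1" and r: "\<forall>j\<in>{1..n}. r j > 0" "mono_on {1..n} r"
    and l: "1 \<le> l" "l \<le> n - 1" and m: "m > 0" and q: "q \<le> m - 1"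
    and e: "e > 0" "real n * e \<ge> 1" "2 * ln (real n) / real m \<le> e"
  shows "\<exists>s :: nat \<Rightarrow> real.
          (\<forall>j\<in>{1..n - l}. s j > 0) \<and>
          proots ((pderiv ^^ (l * m - q)) (P_poly n m r)) =
            replicate_mset q 0 +
            image_mset
              (\<lambda>(j, k). complex_of_real (s j) *
                 exp (2 * complex_of_real pi * \<i> * of_nat k / of_nat m))
              (mset_set ({1..n - l} \<times> {0..m - 1})) \<and>
          (\<forall>j\<in>{1..n - l}.
             r (j + l) * exp (- e)
               * ((real j - real n * e) / (real j + real l - real n * e))
               * of_bool (real j \<ge> real n * e) \<le> s j \<and>
             s j \<le> r (j + l) * exp e
               * ((real j + 1 + real n * e) / (real j + real l + real n * e))
                   powr exp (- e))"
proof -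
  define p where "p = (\<Prod>j=1..n. [:- complex_of_real (r j ^ m), 1:])"
  have rm: "\<forall>j\<in>{1..n}. r j ^ m > 0" "mono_on {1..n} (\<lambda>j. r j ^ m)"
    using r by (auto simp: mono_on_def intro!: power_mono intro: order_less_imp_le)
  have p: "pos_rooted p" "degree p = n" unfolding p_def using rm(1) by (rule pos_rooted_prod_linear)+
  have P: "P_poly n m r = pcompose p (monom 1 m)"
    by (simp only: P_poly_def p_def pcompose_prod_linear_monom)
  \<comment> \<open>Ensures that \<open>l * m - q\<close> is a true difference.\<close>
  have "l * m \<ge> 1 * m" using l by (intro mult_right_mono) auto
  then have d: "l * m - q + q = l * m" "q < m" using q m by linarith+
  obtain g where g: "pos_rooted g" "degree g + l = n"
    "(pderiv ^^ (l * m - q)) (P_poly n m r) = monom 1 q * pcompose g (monom 1 m)"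
    "\<And>i. coeff g i * fact (i * m + q) = coeff p (i + l) * fact ((i + l) * m)"
    using higher_pderiv_pcompose_monom[OF p(1) m d] l diff_le_self[of n 1] order_trans
    unfolding p(2) P by blast
  have N: "degree g = n - l" using g(2) by simp
  obtain c t where t: "c \<noteq> 0" "\<forall>j\<in>{1..n - l}. t j > 0" "mono_on {1..n - l} t"
    "g = smult c (\<Prod>j=1..n - l. [:- complex_of_real (t j), 1:])"
    using pos_rooted_factorization[OF g(1)] unfolding N .
  \<comment> \<open>The roots of \<open>g\<close> are the m-th powers of the moduli.\<close>
  define s where "s j = root m (t j)" for j
  have s: "\<forall>j\<in>{1..n - l}. s j > 0" using t(2) m by (simp add: s_def)
  have sm: "s j ^ m = t j" if "j \<in> {1..n - l}" for j
    using that t(2) m by (simp add: s_def less_imp_le)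
  have "(\<Prod>j=1..n - l. [:- complex_of_real (t j), 1:]) = (\<Prod>j=1..n - l. [:- complex_of_real (s j ^ m), 1:])"
    by (intro prod.cong refl) (simp only: sm)
  with t(4) have g_s: "g = smult c (\<Prod>j=1..n - l. [:- complex_of_real (s j ^ m), 1:])" by simp
  \<comment> \<open>This is n^(2/m), the m-th root of the loss n^2; the third condition on
    \<open>e\<close> bounds it by \<open>exp e\<close>.\<close>
  define K where "K = exp (2 * ln (real n) / real m)"
  have "K ^ m = exp (2 * ln (real n))"
    using m by (simp add: K_def flip: exp_of_nat_mult)
  also have "\<dots> = real n ^ 2" using n by (simp add: exp_double)
  finally have Km: "K ^ m = real n ^ 2" .
  have bounds: "r (j + l) * exp (- e) * ((real j - real n * e) / (real j + real l - real n * e))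
      * of_bool (real j \<ge> real n * e) \<le> s j \<and>
      s j \<le> r (j + l) * exp e * ((real j + 1 + real n * e) / (real j + real l + real n * e)) powr exp (- e)"
    if j: "j \<in> {1..n - l}" for j
  proof -
    obtain i where i: "j = Suc i" using j by (cases j) auto
    have iN: "i < n - l" using i j by auto
    have rj: "r (Suc i + l) > 0" and sj: "s (Suc i) > 0" using r s j i by auto
    have p': "p = smult 1 (\<Prod>j=1..n. [:- complex_of_real (r j ^ m), 1:])" by (simp add: p_def)
    have Nl: "n - l + l = n" using g(2) by simp
    note bd = root_bounds_from_coeff_relation[OF p' one_neq_zero rm t(4,1,2,3) Nl l(1) d(2) iN g(4)]
    \<comment> \<open>Everything is collected into m-th powers of nonnegative numbers, so that the
      exponent can be cancelled.\<close>
    have "(r (Suc i + l) * real i) ^ m \<le> (K * s (Suc i) * real (i + l)) ^ m"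
      using bd(1) sm[OF j] by (simp add: power_mult_distrib Km i)
    then have lo: "r (Suc i + l) * real i \<le> K * s (Suc i) * real (i + l)"
      using m sj by (subst (asm) power_mono_iff) (use rj in \<open>auto simp: K_def\<close>)
    have "(s (Suc i) * real (i + l + 1)) ^ m \<le> (K * r (Suc i + l) * real (i + 2)) ^ m"
      using bd(2) sm[OF j] by (simp add: power_mult_distrib Km i)
    then have up: "s (Suc i) * real (i + l + 1) \<le> K * r (Suc i + l) * real (i + 2)"
      using m sj by (subst (asm) power_mono_iff) (use rj in \<open>auto simp: K_def\<close>)
    have K: "K \<le> exp e" "K > 0" using e(3) by (simp_all add: K_def)
    show ?thesis unfolding i using modulus_bounds[OF rj sj K e(2,1) l(1) lo up] by blast
  qed
  show ?thesis
    using s bounds proots_monom_mult_pcompose[OF m t(1) s g_s] unfolding g(3) by blast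
qed

section \<open>Choice of the sequence and conclusion\<close>

theorem lemma3p2:
  fixes m :: "nat \<Rightarrow> nat"
  assumes m_pos: "\<forall>n\<ge>1. m n > 0"
    and m_growth: "filterlim (\<lambda>n. real (m n) / ln (real n)) at_top sequentially"
  shows "\<exists>\<epsilon> :: nat \<Rightarrow> real.
    (\<forall>n\<ge>2. \<epsilon> n > 0) \<and> \<epsilon> \<longlonglongrightarrow> 0 \<and>
    (\<forall>n\<ge>2. \<forall>r :: nat \<Rightarrow> real. \<forall>l q :: nat.
       (\<forall>j\<in>{1..n}. r j > 0) \<longrightarrow> mono_on {1..n} r \<longrightarrow>
       1 \<le> l \<longrightarrow> l \<le> n - 1 \<longrightarrow> q \<le> m n - 1 \<longrightarrow>
       (\<exists>s :: nat \<Rightarrow> real.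
          (\<forall>j\<in>{1..n - l}. s j > 0) \<and>
          proots ((pderiv ^^ (l * m n - q)) (P_poly n (m n) r)) =
            replicate_mset q 0 +
            image_mset
              (\<lambda>(j, k). complex_of_real (s j) *
                 exp (2 * complex_of_real pi * \<i> * of_nat k / of_nat (m n)))
              (mset_set ({1..n - l} \<times> {0..m n - 1})) \<and>
          (\<forall>j\<in>{1..n - l}.
             r (j + l) * exp (- \<epsilon> n)
               * ((real j - real n * \<epsilon> n) / (real j + real l - real n * \<epsilon> n))
               * of_bool (real j \<ge> real n * \<epsilon> n) \<le> s j \<and>
             s j \<le> r (j + l) * exp (\<epsilon> n)
               * ((real j + 1 + real n * \<epsilon> n) / (real j + real l + real n * \<epsilon> n))
                   powr exp (- \<epsilon> n))))"
proof -
  \<comment> \<open>The first summand makes \<open>exp (\<epsilon> n)\<close> at least n^(2/m_n) and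
    tends to 0 by the growth hypothesis; the second makes \<open>real n * \<epsilon> n\<close> at
    least 1.\<close>
  define \<epsilon> where "\<epsilon> n = 2 * ln (real n) / real (m n) + 1 / real n" for n
  have ln_ge: "2 * ln (real n) / real (m n) \<ge> 0" if "n \<ge> 2" for n using that by simp
  have pos: "\<epsilon> n > 0" and n\<epsilon>: "real n * \<epsilon> n \<ge> 1" and ge: "2 * ln (real n) / real (m n) \<le> \<epsilon> n"
    if "n \<ge> 2" for n
    using ln_ge[OF that] that by (auto simp: \<epsilon>_def distrib_left intro: add_nonneg_pos)
  have "(\<lambda>n. inverse (real (m n) / ln (real n))) \<longlonglongrightarrow> 0"
    using m_growth by (rule tendsto_inverse_0_at_top)
  then have "(\<lambda>n. 2 * inverse (real (m n) / ln (real n)) + 1 / real n) \<longlonglongrightarrow> 2 * 0 + 0"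
    by (intro tendsto_intros lim_1_over_n)
  then have "\<epsilon> \<longlonglongrightarrow> 0" by (simp add: \<epsilon>_def[abs_def])
  then show ?thesis
    using pos n\<epsilon> ge m_pos by (intro exI[of _ \<epsilon>] conjI allI impI higher_pderiv_P_poly) auto
qed

end
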